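(* Let $\sigma\in S_3$ and $n\ge1$. The periodic points of the map $\operatorname{SC}_\sigma:S_n\to S_n$ are precisely the permutations in $S_n$ that avoid both $\sigma$ and $\operatorname{rev}(\sigma)$ consecutively. When $n\geq 2$, each of these periodic points has period $2$.
   Context: $S_n$ is the set of permutations of $[n]$ in one-line notation. Two sequences of distinct integers have the same relative order if replacing the $i$th smallest entry of each by $i$ yields the same word. A permutation $\tau$ contains $\sigma$ consecutively if some consecutive subsequence of $\tau$ has the same relative order as $\sigma$; otherwise it avoids $\sigma$ consecutively. For a set $\mathcal A$ of permutations, $T_{\mathcal A}:S_n\to S_n$ is defined by sending $\pi$ through a stack: at each step, if there is a next input entry and placing it on top of the stack would make the stack contents, read top to bottom, have the same relative order as some element of $\mathcal A$, push it; otherwise pop the top entry of the stack to the end of the output; stop when the output has length $n$. $\operatorname{SC}_\sigma=T_{\mathcal A}$ with $\mathcal A$ the set of permutations avoiding $\sigma$ consecutively. $\operatorname{rev}(\sigma_1\cdots\sigma_k)=\sigma_k\cdots\sigma_1$. A periodic point of $f:S_n\to S_n$ is $\pi$ with $f^t(\pi)=\pi$ for some $t\ge1$; its period is the least such $t$. *)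

theory Defs
  imports "HOL-Library.Sublist" "HOL-Combinatorics.Multiset_Permutations"
begin

abbreviation perms :: "nat \<Rightarrow> nat list set" where
  "perms n \<equiv> permutations_of_set {1..n}"

definition standardize :: "nat list \<Rightarrow> nat list" where
  "standardize xs = map (\<lambda>x. card {y \<in> set xs. y \<le> x}) xs"

definition same_order :: "nat list \<Rightarrow> nat list \<Rightarrow> bool" where
  "same_order xs ys \<longleftrightarrow> standardize xs = standardize ys"

definition contains_consec :: "nat list \<Rightarrow> nat list \<Rightarrow> bool" where
  "contains_consec \<tau> \<sigma> \<longleftrightarrow> (\<exists>ys. sublist ys \<tau> \<and> same_order ys \<sigma>)"

abbreviation avoids_consec :: "nat list \<Rightarrow> nat list \<Rightarrow> bool" where
  "avoids_consec \<tau> \<sigma> \<equiv> \<not> contains_consec \<tau> \<sigma>"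

text \<open>
  The arguments of \<open>stack_run A\<close> are the remaining input, the stack (top entry first) and the
  output so far. If the stack is empty and the next entry may not be pushed, the procedure is
  undefined; the value returned there is arbitrary. This case does not arise when \<open>A\<close> contains
  the permutation of length 1, as it does for \<open>SC \<sigma>\<close> when \<open>\<sigma>\<close> has length at least 2.
\<close>

function stack_run ::
    "nat list set \<Rightarrow> nat list \<Rightarrow> nat list \<Rightarrow> nat list \<Rightarrow> nat list" where
  "stack_run A (x # inp) st out =
     (if \<exists>\<alpha>\<in>A. same_order (x # st) \<alpha> then stack_run A inp (x # st) out
      else (case st of [] \<Rightarrow> out | s # st' \<Rightarrow> stack_run A (x # inp) st' (out @ [s])))"
| "stack_run A [] (s # st) out = stack_run A [] st (out @ [s])"
| "stack_run A [] [] out = out"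
  by pat_completeness auto
termination
  by (relation "measure (\<lambda>(A, inp, st, out). 2 * length inp + length st)") auto

definition stack_map :: "nat list set \<Rightarrow> nat list \<Rightarrow> nat list" where
  "stack_map A \<pi> = stack_run A \<pi> [] []"

definition SC :: "nat list \<Rightarrow> nat list \<Rightarrow> nat list" where
  "SC \<sigma> = stack_map {\<tau>. (\<exists>m. \<tau> \<in> perms m) \<and> avoids_consec \<tau> \<sigma>}"

definition periodic_points :: "'a set \<Rightarrow> ('a \<Rightarrow> 'a) \<Rightarrow> 'a set" where
  "periodic_points S f = {x \<in> S. \<exists>t\<ge>1. (f ^^ t) x = x}"

definition period :: "('a \<Rightarrow> 'a) \<Rightarrow> 'a \<Rightarrow> nat" where
  "period f x = (LEAST t. t \<ge> 1 \<and> (f ^^ t) x = x)"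

lemma mset_stack_run:
  assumes "[1] \<in> A"
  shows "mset (stack_run A inp st out) = mset inp + mset st + mset out"
  using assms
proof (induction A inp st out rule: stack_run.induct)
  case (1 A x inp st out)
  have single: "same_order [x] [1]"
  proof -
    have "{y. y = x \<and> y \<le> x} = {x}" "{y::nat. y = 1 \<and> y \<le> 1} = {1}" by auto
    thus ?thesis by (simp add: same_order_def standardize_def cong: conj_cong)
  qed
  show ?case
  proof (cases "\<exists>\<alpha>\<in>A. same_order (x # st) \<alpha>")
    case True
    thus ?thesis using 1 by simp
  next
    case False
    then obtain s st' where "st = s # st'"
      using single 1(3) by (cases st) auto
    thus ?thesis using 1(2)[OF False] 1(3) False by simp
  qed
qed auto

lemma one_avoids_consec:
  assumes "length \<sigma> \<ge> 2"
  shows "avoids_consec [1] \<sigma>"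
proof
  assume "contains_consec [1] \<sigma>"
  then obtain ys where "sublist ys [1]" "same_order ys \<sigma>"
    by (auto simp: contains_consec_def)
  hence "length ys \<le> 1" "length ys = length \<sigma>"
    using sublist_length_le[of ys "[1]"]
    by (auto simp: same_order_def standardize_def dest: map_eq_imp_length_eq)
  thus False using assms by simp
qed

lemma SC_in_perms:
  assumes "length \<sigma> \<ge> 2" "\<pi> \<in> perms n"
  shows "SC \<sigma> \<pi> \<in> perms n"
proof -
  let ?A = "{\<tau>. (\<exists>m. \<tau> \<in> perms m) \<and> avoids_consec \<tau> \<sigma>}"
  have "[1] \<in> perms 1" by (auto simp: permutations_of_set_def)
  hence "[1] \<in> ?A"
    using one_avoids_consec[OF assms(1)] by blast
  from mset_stack_run[OF this, of \<pi> "[]" "[]"]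
  have "mset (SC \<sigma> \<pi>) = mset \<pi>"
    by (simp add: SC_def stack_map_def)
  thus ?thesis using assms(2)
    by (auto simp: permutations_of_set_def dest: mset_eq_setD mset_eq_imp_distinct_iff)
qed

end

theory Submission imports Defs begin

text \<open>
  If \<open>\<pi>\<close> avoids \<open>rev \<sigma>\<close>, then nothing is popped before the input is exhausted and
  \<open>SC \<sigma> \<pi> = rev \<pi>\<close>; so it suffices to show that a periodic point never causes such an early pop.
  An early pop removes the middle letter \<open>k\<close> of an occurrence \<open>x k s\<close> of \<open>\<sigma>\<close>
  and sends it to the output, in front of everything that remains.

  If \<open>\<sigma>\<close> is monotone, removing \<open>k\<close> does not change the total variation
  (the sum of the differences of adjacent letters). Inserting it after the current output does not
  decrease the variation, and strictly increases it if the output was empty.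
  Total variation is invariant under reversal, so it grows along the orbit until no early pop occurs.

  Otherwise \<open>k\<close> is the largest (or the smallest) of the three letters. By induction on
  \<open>k\<close>, neither \<open>x\<close> nor \<open>s\<close> is popped early anywhere on the orbit, so the set of letters between
  them can only shrink along the orbit, and it loses \<open>k\<close>.
\<close>

section \<open>Relative order and consecutive containment\<close>

lemma same_order_length: "same_order xs ys \<Longrightarrow> length xs = length ys"
  by (auto simp: same_order_def standardize_def dest: map_eq_imp_length_eq)

lemma card_le_iff:
  fixes a b :: nat
  assumes "finite S" "b \<in> S"
  shows "card {y \<in> S. y \<le> b} \<le> card {y \<in> S. y \<le> a} \<longleftrightarrow> b \<le> a"
proof
  assume le: "card {y \<in> S. y \<le> b} \<le> card {y \<in> S. y \<le> a}"
  show "b \<le> a"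
  proof (rule ccontr)
    assume "\<not> b \<le> a"
    hence "{y \<in> S. y \<le> a} \<subset> {y \<in> S. y \<le> b}" using assms by auto
    hence "card {y \<in> S. y \<le> a} < card {y \<in> S. y \<le> b}"
      using assms by (intro psubset_card_mono) auto
    thus False using le by simp
  qed
next
  assume "b \<le> a"
  thus "card {y \<in> S. y \<le> b} \<le> card {y \<in> S. y \<le> a}"
    using assms by (intro card_mono) auto
qed

lemma standardize_nth_le_iff:
  assumes "i < length xs" "j < length xs"
  shows "standardize xs ! i \<le> standardize xs ! j \<longleftrightarrow> xs ! i \<le> xs ! j"
  using assms card_le_iff[of "set xs" "xs ! i" "xs ! j"] by (simp add: standardize_def)

text \<open>Counting positions instead of values expresses a rank through comparisons of positions
  alone, which is what \<open>same_orderI\<close> needs.\<close>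

lemma standardize_nth:
  assumes "distinct xs" "i < length xs"
  shows "standardize xs ! i = card {j. j < length xs \<and> xs ! j \<le> xs ! i}"
proof -
  have "{y \<in> set xs. y \<le> xs ! i} = (!) xs ` {j. j < length xs \<and> xs ! j \<le> xs ! i}"
    by (auto simp: in_set_conv_nth)
  moreover have "inj_on ((!) xs) {j. j < length xs \<and> xs ! j \<le> xs ! i}"
    using assms(1) by (auto simp: inj_on_def nth_eq_iff_index_eq)
  ultimately show ?thesis
    using assms(2) by (simp add: standardize_def card_image)
qed

lemma same_order_nth_le_iff:
  assumes "same_order xs ys" "i < length xs" "j < length xs"
  shows "xs ! i \<le> xs ! j \<longleftrightarrow> ys ! i \<le> ys ! j"
  using assms standardize_nth_le_iff[of i xs j] standardize_nth_le_iff[of i ys j]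
    same_order_length[OF assms(1)]
  by (simp add: same_order_def)

lemma same_orderI:
  assumes "distinct xs" "distinct ys" "length xs = length ys"
    and "\<And>i j. i < length xs \<Longrightarrow> j < length xs \<Longrightarrow> xs ! i \<le> xs ! j \<longleftrightarrow> ys ! i \<le> ys ! j"
  shows "same_order xs ys"
  unfolding same_order_def
proof (rule nth_equalityI)
  show "length (standardize xs) = length (standardize ys)"
    using assms(3) by (simp add: standardize_def)
next
  fix i assume "i < length (standardize xs)"
  hence i: "i < length xs" by (simp add: standardize_def)
  have "{j. j < length xs \<and> xs ! j \<le> xs ! i} = {j. j < length ys \<and> ys ! j \<le> ys ! i}"
    using assms(3,4) i by auto
  thus "standardize xs ! i = standardize ys ! i"
    using standardize_nth[OF assms(1) i] standardize_nth[OF assms(2), of i] i assms(3) by simp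
qed

lemma distinct_same_order:
  assumes "distinct xs" "same_order xs ys"
  shows "distinct ys"
  unfolding distinct_conv_nth
proof (intro allI impI)
  fix i j assume "i < length ys" "j < length ys" "i \<noteq> j"
  thus "ys ! i \<noteq> ys ! j"
    using assms same_order_nth_le_iff[OF assms(2), of i j] same_order_nth_le_iff[OF assms(2), of j i]
      same_order_length[OF assms(2)] nth_eq_iff_index_eq[OF assms(1), of i j]
    by (metis order_antisym order_refl)
qed

lemma standardize_in_perms:
  assumes "distinct xs"
  shows "standardize xs \<in> perms (length xs)"
proof -
  have dist: "distinct (standardize xs)"
    unfolding distinct_conv_nth
  proof (intro allI impI)
    fix i j assume "i < length (standardize xs)" "j < length (standardize xs)" "i \<noteq> j"
    thus "standardize xs ! i \<noteq> standardize xs ! j"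
      using assms standardize_nth_le_iff[of i xs j] standardize_nth_le_iff[of j xs i]
      by (auto simp: standardize_def nth_eq_iff_index_eq)
  qed
  have sub: "set (standardize xs) \<subseteq> {1..length xs}"
  proof
    fix v assume "v \<in> set (standardize xs)"
    then obtain x where x: "x \<in> set xs" "v = card {y \<in> set xs. y \<le> x}"
      by (auto simp: standardize_def)
    have "v \<le> card (set xs)" unfolding x(2) by (rule card_mono) auto
    moreover have "v > 0" unfolding x(2) using x(1) by (auto simp: card_gt_0_iff)
    ultimately show "v \<in> {1..length xs}" using card_length[of xs] by simp
  qed
  have "set (standardize xs) = {1..length xs}"
    using sub distinct_card[OF dist] by (intro card_subset_eq) (simp_all add: standardize_def)
  with dist show ?thesis by (simp add: permutations_of_set_def)
qed

lemma same_order_standardize: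
  assumes "distinct xs"
  shows "same_order xs (standardize xs)"
proof (rule same_orderI[OF assms])
  show "distinct (standardize xs)"
    using standardize_in_perms[OF assms] by (simp add: permutations_of_set_def)
  show "length xs = length (standardize xs)" by (simp add: standardize_def)
qed (simp add: standardize_nth_le_iff)

text \<open>The window of \<open>ys\<close> at the positions that the occurrence takes up in
  \<open>xs\<close> has the same comparisons, hence is an occurrence too.\<close>

lemma contains_consec_same_order:
  assumes "distinct xs" "same_order xs ys" "contains_consec xs \<sigma>"
  shows "contains_consec ys \<sigma>"
proof -
  from assms(3) obtain us p s where xs: "xs = p @ us @ s" and us: "same_order us \<sigma>"
    by (auto simp: contains_consec_def sublist_def)
  define vs where "vs = take (length us) (drop (length p) ys)"
  have len: "length ys = length p + (length us + length s)"
    using same_order_length[OF assms(2)] xs by simp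
  have "same_order us vs"
  proof (rule same_orderI)
    show "distinct us" using assms(1) xs by simp
    show "distinct vs" using distinct_same_order[OF assms(1,2)] by (simp add: vs_def)
    show "length us = length vs" using len by (simp add: vs_def)
    fix i j assume "i < length us" "j < length us"
    thus "us ! i \<le> us ! j \<longleftrightarrow> vs ! i \<le> vs ! j"
      using same_order_nth_le_iff[OF assms(2), of "length p + i" "length p + j"] len
      by (simp add: xs vs_def nth_append)
  qed
  hence "same_order vs \<sigma>" using us by (simp add: same_order_def)
  moreover have "sublist vs ys"
    unfolding vs_def by (meson sublist_take sublist_drop sublist_order.order_trans)
  ultimately show ?thesis by (auto simp: contains_consec_def)
qed

text \<open>This turns the push test of \<open>stack_run\<close> into a condition on the stack
  contents themselves; the witness is their standardization.\<close>

lemma ex_avoiding_perm_iff: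
  assumes "distinct xs"
  shows "(\<exists>\<alpha>\<in>{\<tau>. (\<exists>m. \<tau> \<in> perms m) \<and> avoids_consec \<tau> \<sigma>}. same_order xs \<alpha>)
           \<longleftrightarrow> avoids_consec xs \<sigma>"
proof
  assume "\<exists>\<alpha>\<in>{\<tau>. (\<exists>m. \<tau> \<in> perms m) \<and> avoids_consec \<tau> \<sigma>}. same_order xs \<alpha>"
  thus "avoids_consec xs \<sigma>" using contains_consec_same_order[OF assms] by blast
next
  assume av: "avoids_consec xs \<sigma>"
  have perm: "standardize xs \<in> perms (length xs)" by (rule standardize_in_perms[OF assms])
  have same: "same_order xs (standardize xs)" by (rule same_order_standardize[OF assms])
  hence "same_order (standardize xs) xs" by (simp add: same_order_def)
  hence "avoids_consec (standardize xs) \<sigma>"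
    using contains_consec_same_order[of "standardize xs" xs \<sigma>] perm av
    by (auto simp: permutations_of_set_def)
  thus "\<exists>\<alpha>\<in>{\<tau>. (\<exists>m. \<tau> \<in> perms m) \<and> avoids_consec \<tau> \<sigma>}. same_order xs \<alpha>"
    using perm same by blast
qed

lemma avoids_consec_sublist:
  "avoids_consec xs \<sigma> \<Longrightarrow> sublist ys xs \<Longrightarrow> avoids_consec ys \<sigma>"
  unfolding contains_consec_def by (meson sublist_order.order_trans)

lemma avoids_consec_Nil: "\<sigma> \<noteq> [] \<Longrightarrow> avoids_consec [] \<sigma>"
  by (auto simp: contains_consec_def dest: same_order_length)

text \<open>Ranks depend only on the set of entries, so \<open>standardize\<close> commutes with
  \<open>rev\<close>.\<close>

lemma contains_consec_rev:
  assumes "contains_consec xs \<sigma>"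
  shows "contains_consec (rev xs) (rev \<sigma>)"
proof -
  from assms obtain ys where "sublist ys xs" "same_order ys \<sigma>"
    by (auto simp: contains_consec_def)
  moreover from this have "same_order (rev ys) (rev \<sigma>)"
    by (simp add: same_order_def standardize_def rev_map[symmetric])
  ultimately show ?thesis
    unfolding contains_consec_def by (metis sublist_rev)
qed

lemma contains_consec_rev_iff: "contains_consec (rev xs) \<sigma> \<longleftrightarrow> contains_consec xs (rev \<sigma>)"
  using contains_consec_rev[of xs "rev \<sigma>"] contains_consec_rev[of "rev xs" \<sigma>] by auto

text \<open>An occurrence that was not in \<open>st\<close> must start at \<open>x\<close>. So a
  refused push always comes from \<open>x\<close> and the two top entries of the stack, and a pop
  then leaves at least one entry.\<close>

lemma contains_consec_ConsE:
  assumes "contains_consec (x # st) \<sigma>" "avoids_consec st \<sigma>" "length \<sigma> = 3"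
  obtains s s' st' where "st = s # s' # st'" "same_order [x, s, s'] \<sigma>"
proof -
  from assms(1) obtain ys where ys: "sublist ys (x # st)" "same_order ys \<sigma>"
    by (auto simp: contains_consec_def)
  moreover have "\<not> sublist ys st" using assms(2) ys(2) by (auto simp: contains_consec_def)
  ultimately have "prefix ys (x # st)" by (simp add: sublist_Cons_right)
  then obtain zs where zs: "x # st = ys @ zs" by (auto simp: prefix_def)
  have "length ys = 3" using same_order_length[OF ys(2)] assms(3) by simp
  then obtain a b c where "ys = [a, b, c]"
    by (auto simp: numeral_3_eq_3 length_Suc_conv)
  thus ?thesis using zs ys(2) that by auto
qed

section \<open>Runs of the stack procedure\<close>

abbreviation avoiders :: "nat list \<Rightarrow> nat list set" where
  "avoiders \<sigma> \<equiv> {\<tau>. (\<exists>m. \<tau> \<in> perms m) \<and> avoids_consec \<tau> \<sigma>}"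

lemma stack_run_push:
  assumes "distinct (x # st)" "avoids_consec (x # st) \<sigma>"
  shows "stack_run (avoiders \<sigma>) (x # inp) st out = stack_run (avoiders \<sigma>) inp (x # st) out"
  using ex_avoiding_perm_iff[OF assms(1), of \<sigma>] assms(2) by (simp del: mem_Collect_eq)

lemma stack_run_pop:
  assumes "distinct (x # s # st)" "contains_consec (x # s # st) \<sigma>"
  shows "stack_run (avoiders \<sigma>) (x # inp) (s # st) out =
           stack_run (avoiders \<sigma>) (x # inp) st (out @ [s])"
proof -
  have "\<not> (\<exists>\<alpha>\<in>avoiders \<sigma>. same_order (x # s # st) \<alpha>)"
    using ex_avoiding_perm_iff[OF assms(1), of \<sigma>] assms(2) by blast
  thus ?thesis by (subst stack_run.simps(1)) (simp only: if_False list.case)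
qed

lemma stack_run_Nil: "stack_run A [] st out = out @ st"
  by (induction st arbitrary: out) auto

text \<open>The rule carries along that the entries are distinct and that the stack avoids \<sigma>,
  and hides the push test. The list to watch is \<open>rev inp @ st\<close>, the stack that would
  result from pushing everything else: it starts as \<open>rev \<pi>\<close>, a push leaves it
  unchanged, and an early pop deletes \<open>s\<close> from it.\<close>

lemma stack_run_induct [consumes 3, case_names Nil push pop]:
  assumes "distinct (rev inp @ st)" "avoids_consec st \<sigma>" "length \<sigma> = 3"
    and Nil: "\<And>st out. avoids_consec st \<sigma> \<Longrightarrow> P [] st out (out @ st)"
    and push: "\<And>x inp st out res. P inp (x # st) out res \<Longrightarrow> P (x # inp) st out res"
    and pop: "\<And>x inp s s' st out res. distinct (rev (x # inp) @ s # s' # st) \<Longrightarrow>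
      same_order [x, s, s'] \<sigma> \<Longrightarrow> P (x # inp) (s' # st) (out @ [s]) res \<Longrightarrow>
      P (x # inp) (s # s' # st) out res"
  shows "P inp st out (stack_run (avoiders \<sigma>) inp st out)"
  using assms(1,2)
\<comment> \<open>A push trades weight 2 for weight 1, and a pop removes weight 1.\<close>
proof (induction "2 * length inp + length st" arbitrary: inp st out rule: less_induct)
  case less
  show ?case
  proof (cases inp)
    case Nil
    thus ?thesis using assms(4) less.prems by (simp add: stack_run_Nil)
  next
    case (Cons x inp')
    show ?thesis
    proof (cases "avoids_consec (x # st) \<sigma>")
      case True
      have "P inp' (x # st) out (stack_run (avoiders \<sigma>) inp' (x # st) out)"
        using less.prems True by (intro less.hyps) (auto simp: Cons)
      thus ?thesis
        using push stack_run_push[of x st \<sigma> inp' out] True less.prems(1) by (simp add: Cons)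
    next
      case False
      then obtain s s' st' where st: "st = s # s' # st'" and so: "same_order [x, s, s'] \<sigma>"
        using contains_consec_ConsE[OF _ less.prems(2) assms(3)] by blast
      have "avoids_consec (s' # st') \<sigma>"
        by (rule avoids_consec_sublist[OF less.prems(2)]) (simp add: st sublist_Cons_right)
      hence "P (x # inp') (s' # st') (out @ [s])
               (stack_run (avoiders \<sigma>) (x # inp') (s' # st') (out @ [s]))"
        using less.prems(1) by (intro less.hyps) (auto simp: Cons st)
      moreover have "distinct (rev (x # inp') @ s # s' # st')"
        using less.prems(1) by (simp add: Cons st)
      ultimately show ?thesis
        using pop[OF _ so] stack_run_pop[of x s "s' # st'" \<sigma> inp' out] False less.prems(1)
        by (simp add: Cons st)
    qed
  qed
qed

text \<open>Every stack that is tested is a suffix of \<open>rev \<pi>\<close>, so no push is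
  refused. The final stack is \<open>rev \<pi>\<close>, and it is emptied from the top.\<close>

lemma SC_avoiding:
  assumes "distinct \<pi>" "avoids_consec (rev \<pi>) \<sigma>"
  shows "SC \<sigma> \<pi> = rev \<pi>"
proof -
  have "distinct (rev inp @ st) \<Longrightarrow> avoids_consec (rev inp @ st) \<sigma> \<Longrightarrow>
      stack_run (avoiders \<sigma>) inp st out = out @ rev inp @ st" for inp st out
  proof (induction inp arbitrary: st)
    case Nil
    thus ?case by (simp add: stack_run_Nil)
  next
    case (Cons x inp)
    have "avoids_consec (x # st) \<sigma>"
      by (rule avoids_consec_sublist[OF Cons.prems(2)]) simp
    thus ?case using Cons stack_run_push[of x st \<sigma> inp out] by simp
  qed
  from this[of \<pi> "[]" "[]"] show ?thesis using assms by (simp add: SC_def stack_map_def)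
qed

text \<open>Here \<open>D\<close> collects the early pops and \<open>w\<close> is the stack left
  when the input ends. The triples are only subsequences of \<open>rev \<pi>\<close>, since letters
  between them may have been popped before they became adjacent.\<close>

lemma SC_decomp:
  assumes "distinct \<pi>" "length \<sigma> = 3"
  shows "\<exists>D w. SC \<sigma> \<pi> = D @ w \<and> subseq w (rev \<pi>) \<and>
           (\<forall>k\<in>set D. \<exists>x s. subseq [x, k, s] (rev \<pi>) \<and> same_order [x, k, s] \<sigma>) \<and>
           (D = [] \<longrightarrow> avoids_consec (rev \<pi>) \<sigma>)"
proof -
  define P where "P inp st out res \<longleftrightarrow> (\<exists>D w. res = out @ D @ w \<and> subseq w (rev inp @ st) \<and>
           (\<forall>k\<in>set D. \<exists>x s. subseq [x, k, s] (rev inp @ st) \<and> same_order [x, k, s] \<sigma>) \<and>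
           (D = [] \<longrightarrow> avoids_consec (rev inp @ st) \<sigma>))" for inp st out res
  have "P inp st out (stack_run (avoiders \<sigma>) inp st out)"
    if "distinct (rev inp @ st)" "avoids_consec st \<sigma>" for inp st out
    using that assms(2)
  proof (induction rule: stack_run_induct)
    case (Nil st out)
    thus ?case unfolding P_def by (intro exI[of _ "[]"] exI[of _ st]) simp
  next
    case (push x inp st out res)
    thus ?case by (simp add: P_def)
  next
    case (pop x inp s s' st out res)
    from pop(3) obtain D w where D: "res = (out @ [s]) @ D @ w"
      "subseq w (rev (x # inp) @ s' # st)"
      "\<forall>k\<in>set D. \<exists>x' t. subseq [x', k, t] (rev (x # inp) @ s' # st) \<and> same_order [x', k, t] \<sigma>"
      unfolding P_def by blast
    \<comment> \<open>Deleting \<open>s\<close> only shrinks the list, so triples found later are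
      subsequences of the earlier list as well.\<close>
    have sub: "subseq (rev (x # inp) @ s' # st) (rev (x # inp) @ s # s' # st)"
      by (intro list_emb_append_mono) auto
    \<comment> \<open>The triple that blocked the push is the witness for the new letter
      \<open>s\<close> of \<open>D\<close>.\<close>
    have "subseq [x, s, s'] (rev (x # inp) @ s # s' # st)"
      by (simp add: subseq_drop_many)
    hence "\<forall>k\<in>set (s # D). \<exists>x' t. subseq [x', k, t] (rev (x # inp) @ s # s' # st) \<and>
        same_order [x', k, t] \<sigma>"
      using D(3) pop(2) subseq_order.order_trans[OF _ sub] by (metis set_ConsD)
    moreover have "subseq w (rev (x # inp) @ s # s' # st)"
      by (rule subseq_order.order_trans[OF D(2) sub])
    moreover have "res = out @ (s # D) @ w" using D(1) by simp
    ultimately show ?case unfolding P_def by blast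
  qed
  from this[of \<pi> "[]" "[]"] show ?thesis
    using assms avoids_consec_Nil[of \<sigma>] by (cases "\<sigma> = []") (auto simp: P_def SC_def stack_map_def)
qed

section \<open>Total variation, for monotone patterns\<close>

fun variation :: "nat list \<Rightarrow> int" where
  "variation (x # y # xs) = \<bar>int x - int y\<bar> + variation (y # xs)"
| "variation _ = 0"

lemma variation_append:
  "variation (xs @ y # ys) = variation (xs @ [y]) + variation (y # ys)"
  by (induction xs rule: variation.induct) auto

lemma variation_rev: "variation (rev xs) = variation xs"
proof (induction xs rule: variation.induct)
  case (1 x y xs)
  thus ?case using variation_append[of "rev xs" y "[x]"] by (simp add: abs_minus_commute)
qed auto

text \<open>This is the triangle inequality at an inner place; at the front, one nonnegative term is
  added.\<close>

lemma variation_insert: "variation (xs @ y # ys) \<le> variation (xs @ z # y # ys)"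
  by (induction xs rule: variation.induct) auto

lemma variation_monotone:
  assumes "x < s \<and> s < s' \<or> s' < s \<and> s < x"
  shows "variation (xs @ x # s # s' # ys) = variation (xs @ x # s' # ys)"
  using assms by (induction xs rule: variation.induct) auto

text \<open>The induction follows the variation of \<open>out @ rev inp @ st\<close>. A push does
  not change this list; an early pop moves \<open>s\<close> to the end of \<open>out\<close>. The
  strict bound is claimed only for empty output: it is gained at the first early pop, and the weak
  bound preserves it from there on.\<close>

lemma variation_SC_less:
  assumes "distinct \<pi>" "length \<sigma> = 3" "contains_consec (rev \<pi>) \<sigma>"
    and mono: "\<And>x s s'. same_order [x, s, s'] \<sigma> \<Longrightarrow> x < s \<and> s < s' \<or> s' < s \<and> s < x"
  shows "variation \<pi> < variation (SC \<sigma> \<pi>)"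
proof -
  have "variation (out @ rev inp @ st) \<le> variation (stack_run (avoiders \<sigma>) inp st out) \<and>
      (out = [] \<longrightarrow> contains_consec (rev inp @ st) \<sigma> \<longrightarrow>
        variation (rev inp @ st) < variation (stack_run (avoiders \<sigma>) inp st out))"
    if "distinct (rev inp @ st)" "avoids_consec st \<sigma>" for inp st out
    using that assms(2)
  proof (induction rule: stack_run_induct)
    case (Nil st out)
    thus ?case by simp
  next
    case (push x inp st out res)
    thus ?case by simp
  next
    case (pop x inp s s' st out res)
    have eq: "variation (out @ rev (x # inp) @ s # s' # st)
        = variation (out @ rev (x # inp) @ s' # st)"
      using variation_monotone[OF mono[OF pop(2)], of "out @ rev inp" st] by simp
    \<comment> \<open>The letter \<open>y\<close> is the one in front of which \<open>s\<close> is
      inserted. As \<open>y\<close> differs from \<open>s\<close>, inserting \<open>s\<close> at the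
      very front adds a positive term.\<close>
    obtain y ys where y: "rev (x # inp) @ s' # st = y # ys"
      by (cases "rev (x # inp) @ s' # st") auto
    have "y \<in> set (rev (x # inp) @ s' # st)" unfolding y by simp
    hence "y \<noteq> s" using pop(1) by auto
    hence "variation (y # ys) < variation (s # y # ys)" by simp
    thus ?case using pop(3) eq variation_insert[of out y ys s] unfolding append_assoc y
      by (auto simp del: rev.simps simp: y)
  qed
  from this[of \<pi> "[]" "[]"] show ?thesis
    using assms(1-3) avoids_consec_Nil[of \<sigma>]
    by (cases "\<sigma> = []") (auto simp: SC_def stack_map_def variation_rev)
qed

section \<open>Quantities monotone along orbits, and the letters between two letters\<close>

lemma periodic_points_funpow:
  assumes "\<pi> \<in> periodic_points S f" "f ` S \<subseteq> S"
  shows "(f ^^ i) \<pi> \<in> periodic_points S f"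
proof -
  from assms(1) obtain t where t: "t \<ge> 1" "(f ^^ t) \<pi> = \<pi>" and \<pi>: "\<pi> \<in> S"
    by (auto simp: periodic_points_def)
  have "(f ^^ i) \<pi> \<in> S" using \<pi> assms(2) by (induction i) auto
  moreover have "(f ^^ t) ((f ^^ i) \<pi>) = (f ^^ i) \<pi>"
    using t(2) by (metis add.commute comp_apply funpow_add)
  ultimately show ?thesis using t(1) by (auto simp: periodic_points_def)
qed

text \<open>A quantity that never decreases around a cycle is constant on it. Monotonicity is asked
  for only at periodic points, because \<open>periodic_no_pop\<close> can supply it only there. The
  order may be partial, so that sets can be compared.\<close>

lemma periodic_imp_invariant:
  fixes g :: "'a \<Rightarrow> 'b::order"
  assumes "\<And>x. x \<in> periodic_points S f \<Longrightarrow> g x \<le> g (f x)" "f ` S \<subseteq> S"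
    and "\<pi> \<in> periodic_points S f"
  shows "g (f \<pi>) = g \<pi>"
proof -
  from assms(3) obtain t where t: "t \<ge> 1" "(f ^^ t) \<pi> = \<pi>"
    by (auto simp: periodic_points_def)
  have "g (f \<pi>) \<le> g ((f ^^ Suc i) \<pi>)" for i
  proof (induction i)
    case (Suc i)
    thus ?case
      using assms(1)[OF periodic_points_funpow[OF assms(3,2), of "Suc i"]] by simp
  qed simp
  \<comment> \<open>The iterate \<open>Suc (t - 1)\<close> equals \<open>t\<close>, which closes the
    cycle at \<pi>.\<close>
  from this[of "t - 1"] t have "g (f \<pi>) \<le> g \<pi>" by (cases t) auto
  thus ?thesis using assms(1)[OF assms(3)] by simp
qed

definition between :: "'a \<Rightarrow> 'a \<Rightarrow> 'a list \<Rightarrow> 'a set" where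
  "between a b xs = {c. subseq [a, c, b] xs \<or> subseq [a, c, b] (rev xs)}"

lemma subseq_append_notin:
  assumes "subseq (a # xs) (us @ vs)" "a \<notin> set us"
  shows "subseq (a # xs) vs"
  using assms by (induction us) (auto simp: subseq_Cons2_iff split: if_splits)

lemma subseq_set: "subseq xs ys \<Longrightarrow> set xs \<subseteq> set ys"
  by (blast elim: list_emb_set)

lemma subseq_rev: "subseq xs ys \<Longrightarrow> subseq (rev xs) (rev ys)"
  by (induction rule: list_emb.induct) (auto intro: list_emb_append_mono subseq_rev_drop_many)

lemma subseq_triple_rev: "subseq [a, c, b] (rev xs) \<longleftrightarrow> subseq [b, c, a] xs"
  using subseq_rev[of "[a, c, b]" "rev xs"] subseq_rev[of "[b, c, a]" xs] by auto

text \<open>The function \<open>h\<close> lets one argument serve both kinds of non-monotone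
  pattern: the middle letter is always the largest with respect to \<open>h\<close>. The induction
  on \<open>h k\<close> runs over all periodic points at once, since its hypothesis is used along
  the orbit.\<close>

lemma periodic_no_pop:
  fixes h :: "'a \<Rightarrow> nat"
  assumes closed: "f ` S \<subseteq> S"
    and dist: "\<And>\<pi>. \<pi> \<in> S \<Longrightarrow> distinct \<pi>"
    and f: "\<And>\<pi>. \<pi> \<in> S \<Longrightarrow> f \<pi> = D \<pi> @ w \<pi>"
    and w: "\<And>\<pi>. \<pi> \<in> S \<Longrightarrow> subseq (w \<pi>) (rev \<pi>)"
    and D: "\<And>\<pi> k. \<pi> \<in> S \<Longrightarrow> k \<in> set (D \<pi>) \<Longrightarrow>
      \<exists>x s. subseq [x, k, s] (rev \<pi>) \<and> h x < h k \<and> h s < h k"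
    and per: "\<pi> \<in> periodic_points S f"
  shows "k \<notin> set (D \<pi>)"
  using per
proof (induction "h k" arbitrary: k \<pi> rule: less_induct)
  case less
  show ?case
  proof
    assume k: "k \<in> set (D \<pi>)"
    have S: "\<tau> \<in> S" if "\<tau> \<in> periodic_points S f" for \<tau>
      using that by (simp add: periodic_points_def)
    obtain x s where xs: "subseq [x, k, s] (rev \<pi>)" "h x < h k" "h s < h k"
      using D[OF S[OF less.prems] k] by blast
    \<comment> \<open>By induction neither \<open>x\<close> nor \<open>s\<close> lies in
      \<open>D \<tau>\<close>, so a triple that begins with one of them lies entirely in
      \<open>w \<tau>\<close>.\<close>
    have shift: "subseq [a, c, b] (w \<tau>)"
      if "\<tau> \<in> periodic_points S f" "a \<in> {x, s}" "subseq [a, c, b] (f \<tau>)" for \<tau> a b c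
    proof -
      have "a \<notin> set (D \<tau>)" using less.hyps[OF _ that(1)] xs that(2) by auto
      thus ?thesis using that(3) f[OF S[OF that(1)]] subseq_append_notin by metis
    qed
    have mono: "between x s (f \<tau>) \<subseteq> between x s \<tau>" if "\<tau> \<in> periodic_points S f" for \<tau>
    proof
      fix c assume "c \<in> between x s (f \<tau>)"
      hence "subseq [x, c, s] (w \<tau>) \<or> subseq [s, c, x] (w \<tau>)"
        using shift[OF that] by (auto simp: between_def subseq_triple_rev)
      hence "subseq [x, c, s] (rev \<tau>) \<or> subseq [s, c, x] (rev \<tau>)"
        using subseq_order.order_trans w[OF S[OF that]] by blast
      thus "c \<in> between x s \<tau>" by (auto simp: between_def subseq_triple_rev)
    qed
    have "between x s (f \<pi>) = between x s \<pi>"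
      \<comment> \<open>Taking complements turns a shrinking set into a growing one.\<close>
      using periodic_imp_invariant[where g = "\<lambda>\<tau>. - between x s \<tau>", OF _ closed less.prems]
        mono by auto
    moreover have "k \<in> between x s \<pi>" using xs(1) by (simp add: between_def)
    ultimately have "subseq [x, k, s] (f \<pi>) \<or> subseq [s, k, x] (f \<pi>)"
      by (auto simp: between_def subseq_triple_rev)
    hence "k \<in> set (w \<pi>)"
      using shift[OF less.prems, of x k s] shift[OF less.prems, of s k x]
        subseq_set[of _ "w \<pi>"] by fastforce
    \<comment> \<open>Being still between \<open>x\<close> and \<open>s\<close> forces
      \<open>k\<close> into \<open>w \<pi>\<close>, but it was assumed to be in
      \<open>D \<pi>\<close>, and the two parts share no letter.\<close>
    moreover have "distinct (D \<pi> @ w \<pi>)"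
      using dist f S[OF less.prems] closed by (metis image_subset_iff)
    ultimately show False using k by auto
  qed
qed

section \<open>Periodic points never cause an early pop; the theorem\<close>

lemma periodic_avoids_rev:
  assumes \<sigma>: "\<sigma> \<in> perms 3" and per: "\<pi> \<in> periodic_points (perms n) (SC \<sigma>)"
  shows "avoids_consec (rev \<pi>) \<sigma>"
proof -
  have len: "length \<sigma> = 3" and "distinct \<sigma>"
    using \<sigma> by (auto simp: permutations_of_set_def dest: distinct_card)
  then obtain a b c where abc: "\<sigma> = [a, b, c]" "a \<noteq> b" "b \<noteq> c"
    by (auto simp: numeral_3_eq_3 length_Suc_conv)
  have closed: "SC \<sigma> ` perms n \<subseteq> perms n" using SC_in_perms[of \<sigma>] len by auto
  have \<pi>: "\<pi> \<in> perms n" using per by (simp add: periodic_points_def)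
  have dist: "distinct \<tau>" if "\<tau> \<in> perms n" for \<tau>
    using that by (simp add: permutations_of_set_def)
  have ord: "(x < k \<longleftrightarrow> a < b) \<and> (k < s \<longleftrightarrow> b < c) \<and> (k < x \<longleftrightarrow> b < a) \<and> (s < k \<longleftrightarrow> c < b)"
    if "same_order [x, k, s] \<sigma>" for x k s
    using same_order_nth_le_iff[OF that, of 0 1] same_order_nth_le_iff[OF that, of 1 0]
      same_order_nth_le_iff[OF that, of 1 2] same_order_nth_le_iff[OF that, of 2 1]
    by (simp add: abc not_le[symmetric])
  show ?thesis
  \<comment> \<open>The equivalence holds exactly when \<sigma> is monotone; otherwise
    \<open>b\<close> is the largest or the smallest letter.\<close>
  proof (cases "a < b \<longleftrightarrow> b < c")
    case True
    have mono: "x < s \<and> s < s' \<or> s' < s \<and> s < x" if "same_order [x, s, s'] \<sigma>" for x s s'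
      using ord[OF that] True abc(2,3) by linarith
    have less: "variation \<tau> < variation (SC \<sigma> \<tau>)"
      if "\<tau> \<in> perms n" "contains_consec (rev \<tau>) \<sigma>" for \<tau>
      using variation_SC_less[OF dist[OF that(1)] len that(2) mono] .
    \<comment> \<open>Without an occurrence the map is plain reversal, which preserves
      variation.\<close>
    have "variation \<tau> \<le> variation (SC \<sigma> \<tau>)" if "\<tau> \<in> perms n" for \<tau>
      using less[OF that] SC_avoiding[OF dist[OF that], of \<sigma>]
      by (cases "contains_consec (rev \<tau>) \<sigma>") (auto simp: variation_rev)
    hence "variation (SC \<sigma> \<pi>) = variation \<pi>"
      by (intro periodic_imp_invariant[OF _ closed per]) (simp add: periodic_points_def)
    thus ?thesis using less[OF \<pi>] by auto
  next
    case False
    \<comment> \<open>If the middle letter is the smallest, \<open>n - k\<close> reverses the order.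
      Subtraction on \<open>nat\<close> truncates, so strictness relies on \<open>x\<close> and
      \<open>s\<close> being at most \<open>n\<close>.\<close>
    define h where "h k = (if a < b then k else n - k)" for k
    have "\<forall>\<tau>\<in>perms n. \<exists>D w. SC \<sigma> \<tau> = D @ w \<and> subseq w (rev \<tau>) \<and>
           (\<forall>k\<in>set D. \<exists>x s. subseq [x, k, s] (rev \<tau>) \<and> same_order [x, k, s] \<sigma>) \<and>
           (D = [] \<longrightarrow> avoids_consec (rev \<tau>) \<sigma>)"
      using SC_decomp[OF _ len] dist by blast
    then obtain D w where D: "\<And>\<tau>. \<tau> \<in> perms n \<Longrightarrow> SC \<sigma> \<tau> = D \<tau> @ w \<tau>"
      "\<And>\<tau>. \<tau> \<in> perms n \<Longrightarrow> subseq (w \<tau>) (rev \<tau>)"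
      "\<And>\<tau> k. \<tau> \<in> perms n \<Longrightarrow> k \<in> set (D \<tau>) \<Longrightarrow>
         \<exists>x s. subseq [x, k, s] (rev \<tau>) \<and> same_order [x, k, s] \<sigma>"
      "\<And>\<tau>. \<tau> \<in> perms n \<Longrightarrow> D \<tau> = [] \<Longrightarrow> avoids_consec (rev \<tau>) \<sigma>"
      by metis
    have "\<exists>x s. subseq [x, k, s] (rev \<tau>) \<and> h x < h k \<and> h s < h k"
      if \<tau>: "\<tau> \<in> perms n" and k: "k \<in> set (D \<tau>)" for \<tau> k
    proof -
      obtain x s where xs: "subseq [x, k, s] (rev \<tau>)" "same_order [x, k, s] \<sigma>"
        using D(3)[OF \<tau> k] by blast
      have "set [x, k, s] \<subseteq> set (rev \<tau>)"
        by (rule subseq_set[OF xs(1)])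
      hence "x \<le> n" "s \<le> n" using \<tau> by (auto simp: permutations_of_set_def)
      hence "h x < h k \<and> h s < h k"
        using ord[OF xs(2)] False abc(2,3) by (auto simp: h_def)
      thus ?thesis using xs(1) by blast
    qed
    hence "k \<notin> set (D \<pi>)" for k
      by (intro periodic_no_pop[OF closed dist D(1,2) _ per])
    hence "D \<pi> = []" by (cases "D \<pi>") auto
    thus ?thesis using D(4)[OF \<pi>] by blast
  qed
qed

theorem theorem3p1:
  fixes \<sigma> :: "nat list" and n :: nat
  assumes "\<sigma> \<in> perms 3" and "n \<ge> 1"
  shows "periodic_points (perms n) (SC \<sigma>) =
           {\<pi> \<in> perms n. avoids_consec \<pi> \<sigma> \<and> avoids_consec \<pi> (rev \<sigma>)} \<and>
         (n \<ge> 2 \<longrightarrow> (\<forall>\<pi> \<in> periodic_points (perms n) (SC \<sigma>). period (SC \<sigma>) \<pi> = 2))"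
proof -
  let ?P = "periodic_points (perms n) (SC \<sigma>)"
  let ?V = "{\<pi> \<in> perms n. avoids_consec \<pi> \<sigma> \<and> avoids_consec \<pi> (rev \<sigma>)}"
  have "length \<sigma> = 3"
    using assms(1) by (auto simp: permutations_of_set_def dest: distinct_card)
  hence closed: "SC \<sigma> ` perms n \<subseteq> perms n" using SC_in_perms[of \<sigma>] by auto
  have SC_rev: "SC \<sigma> \<pi> = rev \<pi>" if "\<pi> \<in> perms n" "avoids_consec (rev \<pi>) \<sigma>" for \<pi>
    using SC_avoiding that by (simp add: permutations_of_set_def)
  have "\<pi> \<in> ?V" if per: "\<pi> \<in> ?P" for \<pi>
  proof -
    have \<pi>: "\<pi> \<in> perms n" using per by (simp add: periodic_points_def)
    have av: "avoids_consec (rev \<pi>) \<sigma>" by (rule periodic_avoids_rev[OF assms(1) per])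
    \<comment> \<open>The image \<open>rev \<pi>\<close> is periodic too, and applying the lemma to
      it gives avoidance of \<sigma> by \<pi> itself.\<close>
    have "rev \<pi> \<in> ?P"
      using periodic_points_funpow[OF per closed, of 1] SC_rev[OF \<pi> av] by simp
    from periodic_avoids_rev[OF assms(1) this] show ?thesis
      using \<pi> av by (simp add: contains_consec_rev_iff)
  qed
  moreover have V: "SC \<sigma> \<pi> = rev \<pi>" "(SC \<sigma> ^^ 2) \<pi> = \<pi>" if "\<pi> \<in> ?V" for \<pi>
  proof -
    have "rev \<pi> \<in> perms n" using that by (simp add: permutations_of_set_def)
    thus "SC \<sigma> \<pi> = rev \<pi>" "(SC \<sigma> ^^ 2) \<pi> = \<pi>"
      using that SC_rev[of \<pi>] SC_rev[of "rev \<pi>"]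
      by (simp_all add: contains_consec_rev_iff numeral_2_eq_2)
  qed
  moreover have "\<pi> \<in> ?P" if "\<pi> \<in> ?V" for \<pi>
    using that V(2)[OF that] by (auto simp: periodic_points_def intro: exI[of _ 2])
  ultimately have eq: "?P = ?V" by blast
  have "period (SC \<sigma>) \<pi> = 2" if "n \<ge> 2" "\<pi> \<in> ?P" for \<pi>
    unfolding period_def
  proof (rule Least_equality)
    have \<pi>: "\<pi> \<in> ?V" using that eq by blast
    show "1 \<le> (2::nat) \<and> (SC \<sigma> ^^ 2) \<pi> = \<pi>" using V(2)[OF \<pi>] by simp
    fix t assume t: "1 \<le> t \<and> (SC \<sigma> ^^ t) \<pi> = \<pi>"
    have "distinct \<pi>" "length \<pi> = n"
      using \<pi> by (auto simp: permutations_of_set_def dest: distinct_card)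
    \<comment> \<open>The first and last letters are distinct as \<open>n\<close> is at least 2, so
      reversal moves \<pi> and period 1 is excluded.\<close>
    hence "rev \<pi> ! 0 \<noteq> \<pi> ! 0"
      using that(1) by (simp add: rev_nth nth_eq_iff_index_eq)
    hence "SC \<sigma> \<pi> \<noteq> \<pi>" using V(1)[OF \<pi>] by auto
    hence "t \<noteq> 1" using t by auto
    thus "2 \<le> t" using t by simp
  qed
  thus ?thesis using eq by blast
qed

end
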